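(* Every data structure that maintains a weighted rooted forest with $n$ vertices under the operations \textsf{subtree-sum} and \textsf{cut} requires $\Omega(n\log n)$ time for $\Theta(n)$ operations, in the Word RAM model of computation and with weight group $G=\mathbb{Z}$.
   Context: The data structure is initialized with a rooted forest $F$ with integer vertex weights $w\colon V(F)\to\mathbb{Z}$ and processes online: $\textsf{cut}(v)$, which deletes the edge between $v$ and its parent (legal only if $v$ is not a root), and $\textsf{subtree-sum}(v)$, which returns the sum of weights of the vertices in the subtree of the current forest rooted at $v$ (i.e., $v$ and all its current descendants). No weight updates are available. The Word RAM has words of $\Theta(\log n)$ bits. *)

theory Defs
  imports Complex_Main "HOL-Library.Landau_Symbols"
begin

text \<open>A forest is given by a parent map: par v = None means v is a root.\<close>

fun anc_iter :: "(nat \<Rightarrow> nat option) \<Rightarrow> nat \<Rightarrow> nat \<Rightarrow> nat option" where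
  "anc_iter par 0 x = Some x"
| "anc_iter par (Suc k) x = (case anc_iter par k x of None \<Rightarrow> None | Some y \<Rightarrow> par y)"

definition rooted_forest :: "nat \<Rightarrow> (nat \<Rightarrow> nat option) \<Rightarrow> bool" where
  "rooted_forest n par \<longleftrightarrow>
     (\<forall>v p. par v = Some p \<longrightarrow> v < n \<and> p < n) \<and>
     (\<forall>v<n. \<exists>k. anc_iter par k v \<noteq> None \<and> par (the (anc_iter par k v)) = None)"

definition in_subtree :: "(nat \<Rightarrow> nat option) \<Rightarrow> nat \<Rightarrow> nat \<Rightarrow> bool" where
  "in_subtree par u x \<longleftrightarrow> (\<exists>k. anc_iter par k x = Some u)"

definition subtree_sum :: "nat \<Rightarrow> (nat \<Rightarrow> nat option) \<Rightarrow> (nat \<Rightarrow> int) \<Rightarrow> nat \<Rightarrow> int" where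
  "subtree_sum n par wt u = (\<Sum>x\<in>{x. x < n \<and> in_subtree par u x}. wt x)"

datatype forest_op = Cut nat | SubtreeSum nat

fun legal_ops :: "nat \<Rightarrow> (nat \<Rightarrow> nat option) \<Rightarrow> forest_op list \<Rightarrow> bool" where
  "legal_ops n par [] = True"
| "legal_ops n par (Cut v # ops) = (v < n \<and> par v \<noteq> None \<and> legal_ops n (par(v := None)) ops)"
| "legal_ops n par (SubtreeSum v # ops) = (v < n \<and> legal_ops n par ops)"

fun answers :: "nat \<Rightarrow> (nat \<Rightarrow> nat option) \<Rightarrow> (nat \<Rightarrow> int) \<Rightarrow> forest_op list \<Rightarrow> int option list" where
  "answers n par wt [] = []"
| "answers n par wt (Cut v # ops) = None # answers n (par(v := None)) wt ops"
| "answers n par wt (SubtreeSum v # ops) = Some (subtree_sum n par wt v) # answers n par wt ops"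

section \<open>Cell-probe model (generalizing the Word RAM)\<close>

text \<open>An operation is an adaptive decision tree of memory probes: read a cell and branch
  on its content, or write a word to a cell; each probe costs one unit.\<close>
datatype 'r prog = Ret 'r | Read nat "nat \<Rightarrow> 'r prog" | Write nat nat "'r prog"

primrec run :: "'r prog \<Rightarrow> (nat \<Rightarrow> nat) \<Rightarrow> 'r \<times> (nat \<Rightarrow> nat) \<times> nat" where
  "run (Ret r) m = (r, m, 0)"
| "run (Read a k) m = (case run (k (m a)) m of (r, m', c) \<Rightarrow> (r, m', Suc c))"
| "run (Write a v p) m = (case run p (m(a := v)) of (r, m', c) \<Rightarrow> (r, m', Suc c))"

primrec wf_prog :: "nat \<Rightarrow> 'r prog \<Rightarrow> bool" where
  "wf_prog b (Ret r) = True"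
| "wf_prog b (Read a k) = (a < 2 ^ b \<and> (\<forall>v < 2 ^ b. wf_prog b (k v)))"
| "wf_prog b (Write a v p) = (a < 2 ^ b \<and> v < 2 ^ b \<and> wf_prog b p)"

text \<open>A data structure: initial memory computed from the forest (preprocessing free),
  and for each n and vertex v the probe programs for cut(v) and subtree-sum(v).\<close>
record ds =
  ds_init :: "nat \<Rightarrow> (nat \<Rightarrow> nat option) \<Rightarrow> (nat \<Rightarrow> int) \<Rightarrow> nat \<Rightarrow> nat"
  cut_prog :: "nat \<Rightarrow> nat \<Rightarrow> unit prog"
  query_prog :: "nat \<Rightarrow> nat \<Rightarrow> int prog"

fun run_seq :: "ds \<Rightarrow> nat \<Rightarrow> (nat \<Rightarrow> nat) \<Rightarrow> forest_op list \<Rightarrow> int option list \<times> nat" where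
  "run_seq D n m [] = ([], 0)"
| "run_seq D n m (Cut v # ops) =
     (case run (cut_prog D n v) m of (_, m', c) \<Rightarrow>
        (case run_seq D n m' ops of (outs, c') \<Rightarrow> (None # outs, c + c')))"
| "run_seq D n m (SubtreeSum v # ops) =
     (case run (query_prog D n v) m of (r, m', c) \<Rightarrow>
        (case run_seq D n m' ops of (outs, c') \<Rightarrow> (Some r # outs, c + c')))"

definition ds_correct :: "(nat \<Rightarrow> nat) \<Rightarrow> ds \<Rightarrow> bool" where
  "ds_correct w D \<longleftrightarrow>
     (\<forall>n v. v < n \<longrightarrow> wf_prog (w n) (cut_prog D n v) \<and> wf_prog (w n) (query_prog D n v)) \<and>
     (\<forall>n par wt. rooted_forest n par \<and> (\<forall>x<n. \<bar>wt x\<bar> < 2 ^ w n) \<longrightarrow>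
        (\<forall>a. ds_init D n par wt a < 2 ^ w n) \<and>
        (\<forall>ops. legal_ops n par ops \<longrightarrow>
            fst (run_seq D n (ds_init D n par wt) ops) = answers n par wt ops))"

end

theory Submission
  imports Defs "HOL-Library.FuncSet"
begin

text \<open>The proof is an information transfer argument. The forest is a path whose vertices carry leaves of
  distinct weights. In a round, the path vertices are visited in bit-reversal order; at each of them
  one remaining leaf is cut and the subtree sum is queried. Bisect a block of the round: the path
  vertices visited in the two halves interleave, so the answers in the second half determine all
  choices made in the first half. Hence many cells written in the first half must be read in the
  second half, on average a constant fraction of the number of operations, because a choice carries
  as many bits as a word, up to a constant factor. The transfers at different
  nodes of the bisection tree are charged to different probes, which yields the logarithmic factor.
  Choosing one expensive round after the other gives the bound.\<close>

section \<open>Probe programs\<close>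

text \<open>Sequential composition turns a whole operation sequence into one program, so that
  exposed reads and written cells can be studied for blocks of operations.\<close>

primrec bind_prog :: "'a prog \<Rightarrow> ('a \<Rightarrow> 'b prog) \<Rightarrow> 'b prog" where
  "bind_prog (Ret r) f = f r"
| "bind_prog (Read a k) f = Read a (\<lambda>x. bind_prog (k x) f)"
| "bind_prog (Write a v p) f = Write a v (bind_prog p f)"

definition result :: "'r prog \<Rightarrow> (nat \<Rightarrow> nat) \<Rightarrow> 'r" where
  "result p m = fst (run p m)"

definition final_mem :: "'r prog \<Rightarrow> (nat \<Rightarrow> nat) \<Rightarrow> nat \<Rightarrow> nat" where
  "final_mem p m = fst (snd (run p m))"

definition cost :: "'r prog \<Rightarrow> (nat \<Rightarrow> nat) \<Rightarrow> nat" where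
  "cost p m = snd (snd (run p m))"

text \<open>The cells whose first access is a read, i.e. whose initial content matters.\<close>

primrec exposed_reads :: "'r prog \<Rightarrow> (nat \<Rightarrow> nat) \<Rightarrow> nat set" where
  "exposed_reads (Ret r) m = {}"
| "exposed_reads (Read a k) m = insert a (exposed_reads (k (m a)) m)"
| "exposed_reads (Write a v p) m = exposed_reads p (m(a := v)) - {a}"

primrec written :: "'r prog \<Rightarrow> (nat \<Rightarrow> nat) \<Rightarrow> nat set" where
  "written (Ret r) m = {}"
| "written (Read a k) m = written (k (m a)) m"
| "written (Write a v p) m = insert a (written p (m(a := v)))"

lemma run_simps [simp]:
  "result (Ret r) m = r" "final_mem (Ret r) m = m" "cost (Ret r) m = 0"
  "result (Read a k) m = result (k (m a)) m"
  "final_mem (Read a k) m = final_mem (k (m a)) m"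
  "cost (Read a k) m = Suc (cost (k (m a)) m)"
  "result (Write a v p) m = result p (m(a := v))"
  "final_mem (Write a v p) m = final_mem p (m(a := v))"
  "cost (Write a v p) m = Suc (cost p (m(a := v)))"
  by (auto simp: result_def final_mem_def cost_def split: prod.splits)

lemma run_eq: "run p m = (result p m, final_mem p m, cost p m)"
  by (simp add: result_def final_mem_def cost_def)

lemma bind_prog_simps [simp]:
  "result (bind_prog p f) m = result (f (result p m)) (final_mem p m)"
  "final_mem (bind_prog p f) m = final_mem (f (result p m)) (final_mem p m)"
  "cost (bind_prog p f) m = cost p m + cost (f (result p m)) (final_mem p m)"
  "written (bind_prog p f) m = written p m \<union> written (f (result p m)) (final_mem p m)"
  by (induction p arbitrary: m) auto

text \<open>The second program sees an initial content only in cells that the first has not written.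
  When the programs are the two halves of a block, the cells removed here are the information
  transfer.\<close>

lemma exposed_reads_bind_prog [simp]:
  "exposed_reads (bind_prog p f) m =
     exposed_reads p m \<union> (exposed_reads (f (result p m)) (final_mem p m) - written p m)"
  by (induction p arbitrary: m) auto

lemma wf_bind_prog: "wf_prog b p \<Longrightarrow> (\<And>x. wf_prog b (f x)) \<Longrightarrow> wf_prog b (bind_prog p f)"
  by (induction p) auto

lemma finite_exposed_reads [simp]: "finite (exposed_reads p m)"
  by (induction p arbitrary: m) auto

text \<open>Each exposed cell is paid for by its own read probe. The base case of
  \<open>block_cost\<close> rests on this.\<close>

lemma card_exposed_reads_le_cost: "card (exposed_reads p m) \<le> cost p m"
proof (induction p arbitrary: m)
  case (Read a k)
  have "card (exposed_reads (k (m a)) m) \<le> cost (k (m a)) m"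
    by (rule Read) simp
  then show ?case
    by (simp add: card_insert_if)
next
  case (Write a v p)
  have "card (exposed_reads p (m(a := v)) - {a}) \<le> card (exposed_reads p (m(a := v)))"
    by (rule card_mono) auto
  also have "\<dots> \<le> cost p (m(a := v))"
    by (rule Write)
  finally show ?case
    by simp
qed auto

lemma final_mem_not_written: "a \<notin> written p m \<Longrightarrow> final_mem p m a = m a"
proof (induction p arbitrary: m)
  case (Write b v p)
  from Write.prems have "a \<noteq> b" "a \<notin> written p (m(b := v))" by simp_all
  have "final_mem p (m(b := v)) a = (m(b := v)) a"
    by (rule Write.IH) fact
  with \<open>a \<noteq> b\<close> show ?case by simp
qed simp_all

text \<open>\<open>wf_prog\<close> restricts only the branches taken on words below
  \<open>2 ^ b\<close>, so the memory has to be bounded too. These bounds later put all transferred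
  address-content pairs into a finite universe.\<close>

lemma wf_prog_bounds:
  assumes "wf_prog b p" "\<And>a. m a < 2 ^ b"
  shows "exposed_reads p m \<subseteq> {..<2 ^ b}" "final_mem p m a < 2 ^ b"
proof -
  have "exposed_reads p m \<subseteq> {..<2 ^ b} \<and> (\<forall>a. final_mem p m a < 2 ^ b)"
    using assms
  proof (induction p arbitrary: m)
    case (Read a k)
    then have "wf_prog b (k (m a))" by simp
    from Read.IH[OF _ this Read.prems(2)] Read.prems(1) show ?case by simp
  next
    case (Write a v p)
    have "exposed_reads p (m(a := v)) \<subseteq> {..<2 ^ b} \<and> (\<forall>c. final_mem p (m(a := v)) c < 2 ^ b)"
      by (rule Write.IH) (use Write.prems in auto)
    then show ?case by auto
  qed auto
  then show "exposed_reads p m \<subseteq> {..<2 ^ b}" "final_mem p m a < 2 ^ b" by auto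
qed

text \<open>Probes are adaptive, but every value that steers the run comes from an exposed cell or
  was written by the program itself, so both runs follow the same branch.\<close>

lemma result_cong_exposed_reads:
  assumes "\<And>a. a \<in> exposed_reads p m \<Longrightarrow> m a = m' a"
  shows "result p m = result p m'"
  using assms
proof (induction p arbitrary: m m')
  case (Read a k)
  have "m a = m' a" by (rule Read.prems) simp
  moreover have "result (k (m a)) m = result (k (m a)) m'"
  proof (rule Read.IH)
    show "m b = m' b" if "b \<in> exposed_reads (k (m a)) m" for b
      by (rule Read.prems) (simp add: that)
  qed simp
  ultimately show ?case by simp
next
  case (Write a v p)
  have "result p (m(a := v)) = result p (m'(a := v))"
  proof (rule Write.IH)
    show "(m(a := v)) b = (m'(a := v)) b" if "b \<in> exposed_reads p (m(a := v))" for b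
    proof (cases "b = a")
      case False
      then have "m b = m' b" by (intro Write.prems) (simp add: that)
      then show ?thesis by simp
    qed simp
  qed
  then show ?case by simp
qed auto

section \<open>Operation sequences as single programs\<close>

fun seq_prog :: "ds \<Rightarrow> nat \<Rightarrow> forest_op list \<Rightarrow> int option list prog" where
  "seq_prog D n [] = Ret []"
| "seq_prog D n (Cut v # ops) =
     bind_prog (cut_prog D n v) (\<lambda>_. bind_prog (seq_prog D n ops) (\<lambda>rs. Ret (None # rs)))"
| "seq_prog D n (SubtreeSum v # ops) =
     bind_prog (query_prog D n v) (\<lambda>r. bind_prog (seq_prog D n ops) (\<lambda>rs. Ret (Some r # rs)))"

lemma run_seq_eq:
  "run_seq D n m ops = (result (seq_prog D n ops) m, cost (seq_prog D n ops) m)"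
  by (induction D n m ops rule: run_seq.induct) (simp_all add: run_eq)

lemma seq_prog_append [simp]:
  "result (seq_prog D n (xs @ ys)) m =
     result (seq_prog D n xs) m @ result (seq_prog D n ys) (final_mem (seq_prog D n xs) m)"
  "final_mem (seq_prog D n (xs @ ys)) m =
     final_mem (seq_prog D n ys) (final_mem (seq_prog D n xs) m)"
  "cost (seq_prog D n (xs @ ys)) m =
     cost (seq_prog D n xs) m + cost (seq_prog D n ys) (final_mem (seq_prog D n xs) m)"
  "exposed_reads (seq_prog D n (xs @ ys)) m =
     exposed_reads (seq_prog D n xs) m \<union>
     (exposed_reads (seq_prog D n ys) (final_mem (seq_prog D n xs) m) - written (seq_prog D n xs) m)"
  by (induction D n xs arbitrary: m rule: seq_prog.induct) auto

lemma length_result_seq_prog [simp]: "length (result (seq_prog D n ops) m) = length ops"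
  by (induction D n ops arbitrary: m rule: seq_prog.induct) auto

lemma length_answers [simp]: "length (answers n par wt ops) = length ops"
  by (induction n par wt ops rule: answers.induct) (auto simp del: fun_upd_apply)

fun forest_after :: "(nat \<Rightarrow> nat option) \<Rightarrow> forest_op list \<Rightarrow> nat \<Rightarrow> nat option" where
  "forest_after par [] = par"
| "forest_after par (Cut v # ops) = forest_after (par(v := None)) ops"
| "forest_after par (SubtreeSum v # ops) = forest_after par ops"

lemma answers_append:
  "answers n par wt (xs @ ys) = answers n par wt xs @ answers n (forest_after par xs) wt ys"
  by (induction n par wt xs rule: answers.induct) (auto simp del: fun_upd_apply)

lemma legal_ops_append:
  "legal_ops n par (xs @ ys) \<longleftrightarrow> legal_ops n par xs \<and> legal_ops n (forest_after par xs) ys"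
  by (induction n par xs rule: legal_ops.induct) (auto simp del: fun_upd_apply)

lemma forest_after_append: "forest_after par (xs @ ys) = forest_after (forest_after par xs) ys"
  by (induction par xs rule: forest_after.induct) (auto simp del: fun_upd_apply)

section \<open>Counting small sets\<close>

text \<open>A subset with at most \<open>k\<close> elements is listed by a word of length
  \<open>k\<close> over \<open>U\<close> and one blank letter, here \<open>None\<close>, which pads
  the smaller sets.\<close>

lemma card_small_subsets_le:
  assumes "finite U"
  shows "finite {X. X \<subseteq> U \<and> card X \<le> k}" "card {X. X \<subseteq> U \<and> card X \<le> k} \<le> (card U + 1) ^ k"
proof -
  let ?V = "insert None (Some ` U)"
  let ?L = "{xs. set xs \<subseteq> ?V \<and> length xs = k}"
  let ?F = "\<lambda>xs. {x. Some x \<in> set xs}"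
  show fin: "finite {X. X \<subseteq> U \<and> card X \<le> k}"
    using assms by simp
  have "{X. X \<subseteq> U \<and> card X \<le> k} \<subseteq> ?F ` ?L"
  proof
    fix X assume X: "X \<in> {X. X \<subseteq> U \<and> card X \<le> k}"
    then have "finite X" using assms finite_subset by auto
    then obtain xs where xs: "set xs = X" "distinct xs"
      using finite_distinct_list by blast
    let ?ys = "map Some xs @ replicate (k - card X) None"
    have "?F ?ys = X" using xs by auto
    moreover have "?ys \<in> ?L" using xs X distinct_card[OF xs(2)] by auto
    ultimately show "X \<in> ?F ` ?L" by blast
  qed
  moreover have finL: "finite ?L" using assms by (simp add: finite_lists_length_eq)
  ultimately have "card {X. X \<subseteq> U \<and> card X \<le> k} \<le> card ?L"
    by (meson card_image_le card_mono finite_imageI le_trans)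
  also have "\<dots> = (card U + 1) ^ k"
    using assms by (simp add: card_lists_length_eq card_image)
  finally show "card {X. X \<subseteq> U \<and> card X \<le> k} \<le> (card U + 1) ^ k" .
qed

text \<open>Encoding argument: there are too few sets of size at most \<open>k\<close> to encode
  more than half of \<open>X\<close>, so at least half of the codes are larger than
  \<open>k\<close>.\<close>

lemma sum_card_ge_of_inj_on:
  fixes M :: "'a \<Rightarrow> 'b set"
  assumes "finite X" "finite U" and inj: "inj_on M X" and sub: "\<And>x. x \<in> X \<Longrightarrow> M x \<subseteq> U"
    and big: "2 * (card U + 1) ^ k \<le> card X"
  shows "k * card X \<le> 2 * (\<Sum>x\<in>X. card (M x))"
proof -
  define B where "B = {x \<in> X. card (M x) \<le> k}"
  have finB: "finite B" using assms unfolding B_def by simp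
  have "card B = card (M ` B)"
    using inj by (metis (no_types, lifting) B_def card_image inj_on_subset mem_Collect_eq subsetI)
  also have "\<dots> \<le> card {Y. Y \<subseteq> U \<and> card Y \<le> k}"
    using sub card_small_subsets_le(1)[OF \<open>finite U\<close>] by (intro card_mono) (auto simp: B_def)
  also have "\<dots> \<le> (card U + 1) ^ k"
    by (rule card_small_subsets_le) fact
  finally have "2 * card B \<le> card X" using big by linarith
  moreover have "card (X - B) = card X - card B"
    using finB by (intro card_Diff_subset) (auto simp: B_def)
  ultimately have "card X \<le> 2 * card (X - B)" by linarith
  then have "k * card X \<le> 2 * (k * card (X - B))"
    by (metis mult.left_commute mult_le_mono2)
  also have "k * card (X - B) = (\<Sum>x\<in>X - B. k)" by simp
  also have "\<dots> \<le> (\<Sum>x\<in>X - B. card (M x))"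
    by (intro sum_mono) (auto simp: B_def)
  also have "\<dots> \<le> (\<Sum>x\<in>X. card (M x))"
    using \<open>finite X\<close> by (intro sum_mono2) auto
  finally show ?thesis by simp
qed

text \<open>Choices on disjoint index sets are independent, so an average over a block is an
  iterated average over its two halves.\<close>

lemma sum_PiE_Un:
  assumes "I \<inter> J = {}"
  shows "(\<Sum>f\<in>PiE (I \<union> J) A. F f) =
    (\<Sum>g\<in>PiE I A. \<Sum>h\<in>PiE J A. F (\<lambda>i. if i \<in> I then g i else h i))"
proof -
  let ?i = "\<lambda>(g, h) i. if i \<in> I then g i else h i"
  let ?j = "\<lambda>f. (restrict f I, restrict f J)"
  have "?i (?j f) = f" if "f \<in> PiE (I \<union> J) A" for f
    using that by (auto simp: restrict_def PiE_def extensional_def intro!: ext)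
  moreover have "?j f \<in> PiE I A \<times> PiE J A" if "f \<in> PiE (I \<union> J) A" for f
    using that by auto
  moreover have "?j (?i x) = x" if "x \<in> PiE I A \<times> PiE J A" for x
    using that assms
    by (cases x) (auto simp: restrict_def PiE_def extensional_def disjoint_iff intro!: ext)
  moreover have "?i x \<in> PiE (I \<union> J) A" if "x \<in> PiE I A \<times> PiE J A" for x
    using that by (cases x) (auto simp: PiE_iff extensional_def)
  ultimately have "(\<Sum>f\<in>PiE (I \<union> J) A. F f) = (\<Sum>x\<in>PiE I A \<times> PiE J A. F (?i x))"
    by (intro sum.reindex_bij_witness[where i = ?i and j = ?j]) auto
  then show ?thesis by (simp add: sum.cartesian_product case_prod_beta)
qed

section \<open>The bit-reversal order\<close>

text \<open>The arithmetic progression with start \<open>c\<close>, difference \<open>d\<close> and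
  \<open>2 ^ l\<close> terms in bit-reversal order: terms of even position first, then those of odd
  position, recursively.\<close>

fun bit_rev :: "nat \<Rightarrow> nat \<Rightarrow> nat \<Rightarrow> nat list" where
  "bit_rev 0 c d = [c]"
| "bit_rev (Suc l) c d = bit_rev l c (2 * d) @ bit_rev l (c + d) (2 * d)"

lemma length_bit_rev [simp]: "length (bit_rev l c d) = 2 ^ l"
  by (induction l c d rule: bit_rev.induct) auto

lemma set_bit_rev: "set (bit_rev l c d) = (\<lambda>y. c + y * d) ` {..<2 ^ l}"
proof (induction l c d rule: bit_rev.induct)
  case (2 l c d)
  have "(\<lambda>y. c + y * d) ` {..<2 ^ Suc l} =
      (\<lambda>y. c + y * (2 * d)) ` {..<2 ^ l} \<union> (\<lambda>y. c + d + y * (2 * d)) ` {..<2 ^ l}" (is "?A = ?B")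
  proof
    show "?A \<subseteq> ?B"
    proof
      fix x assume "x \<in> ?A"
      then obtain y where y: "y < 2 ^ Suc l" "x = c + y * d" by auto
      show "x \<in> ?B"
      proof (cases "even y")
        case True
        then obtain z where "y = 2 * z" by blast
        then show ?thesis using y by (auto simp: algebra_simps intro!: image_eqI[of _ _ z])
      next
        case False
        then obtain z where "y = 2 * z + 1" by (blast elim: oddE)
        then show ?thesis using y by (auto simp: algebra_simps intro!: image_eqI[of _ _ z])
      qed
    qed
    show "?B \<subseteq> ?A"
    proof
      fix x assume "x \<in> ?B"
      then obtain y where y: "y < 2 ^ l" "x = c + y * (2 * d) \<or> x = c + d + y * (2 * d)" by auto
      then have "x = c + (2 * y) * d \<or> x = c + (2 * y + 1) * d" by (auto simp: algebra_simps)
      moreover have "2 * y < 2 ^ Suc l" "2 * y + 1 < 2 ^ Suc l" using y(1) by auto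
      ultimately show "x \<in> ?A" by blast
    qed
  qed
  with 2 show ?case by simp
qed auto

lemma bit_rev_halves_disjoint:
  assumes "d > 0"
  shows "set (bit_rev l c (2 * d)) \<inter> set (bit_rev l (c + d) (2 * d)) = {}"
proof -
  have "c + y * (2 * d) \<noteq> c + d + z * (2 * d)" for y z
  proof
    assume "c + y * (2 * d) = c + d + z * (2 * d)"
    then have "(2 * y) * d = (2 * z + 1) * d" by (simp add: algebra_simps)
    then have "2 * y = 2 * z + 1" using assms by (metis mult_cancel2 less_irrefl)
    then show False by presburger
  qed
  then show ?thesis by (auto simp: set_bit_rev)
qed

lemma card_set_bit_rev:
  assumes "d > 0"
  shows "card (set (bit_rev l c d)) = 2 ^ l"
  using assms unfolding set_bit_rev by (subst card_image) (auto simp: inj_on_def)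

lemma distinct_bit_rev: "d > 0 \<Longrightarrow> distinct (bit_rev l c d)"
  by (simp add: card_distinct card_set_bit_rev)

text \<open>Between two consecutive indices of the first half lies one of the second half.\<close>

lemma bit_rev_prefix_sums_determine:
  fixes g g' :: "nat \<Rightarrow> nat"
  assumes d: "d > 0"
    and eq: "\<And>r. r \<in> set (bit_rev l (c + d) (2 * d)) \<Longrightarrow>
      (\<Sum>i\<in>{i \<in> set (bit_rev l c (2 * d)). i \<le> r}. g i) =
      (\<Sum>i\<in>{i \<in> set (bit_rev l c (2 * d)). i \<le> r}. g' i)"
    and i: "i \<in> set (bit_rev l c (2 * d))"
  shows "g i = g' i"
proof -
  define x where "x = (\<lambda>y. c + y * (2 * d))"
  have inj: "inj_on x Y" for Y using d by (auto simp: x_def inj_on_def)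
  have sums: "(\<Sum>y\<le>z. g (x y)) = (\<Sum>y\<le>z. g' (x y))" if z: "z < 2 ^ l" for z
  proof -
    \<comment> \<open>The index \<open>c + d + z * (2 * d)\<close> lies strictly between
      \<open>x z\<close> and \<open>x (z + 1)\<close>, so it cuts off exactly the first
      \<open>z + 1\<close> terms.\<close>
    have "{i \<in> set (bit_rev l c (2 * d)). i \<le> c + d + z * (2 * d)} = x ` {..z}"
    proof -
      have "x y \<le> c + d + z * (2 * d) \<longleftrightarrow> y \<le> z" for y
      proof
        assume "x y \<le> c + d + z * (2 * d)"
        then have "(2 * y) * d \<le> (2 * z + 1) * d" by (simp add: x_def algebra_simps)
        then have "2 * y \<le> 2 * z + 1" using d by (simp only: mult_le_cancel2)
        then show "y \<le> z" by simp
      next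
        assume "y \<le> z"
        then have "y * (2 * d) \<le> z * (2 * d)" by simp
        then show "x y \<le> c + d + z * (2 * d)" by (simp only: x_def)
      qed
      then show ?thesis
        using z unfolding set_bit_rev x_def[symmetric] by auto
    qed
    moreover have "c + d + z * (2 * d) \<in> set (bit_rev l (c + d) (2 * d))"
      using z by (auto simp: set_bit_rev)
    ultimately show ?thesis
      using eq[of "c + d + z * (2 * d)"] by (simp add: sum.reindex[OF inj])
  qed
  obtain z where z: "z < 2 ^ l" "i = x z"
    using i by (auto simp: set_bit_rev x_def)
  \<comment> \<open>Consecutive prefix sums differ by a single value of \<open>g\<close>; for
    \<open>z = 0\<close> the prefix sum is already that value.\<close>
  show ?thesis
  proof (cases z)
    case 0
    then show ?thesis using sums[of 0] z by simp
  next
    case (Suc u)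
    then show ?thesis using sums[of u] sums[of z] z by simp
  qed
qed

section \<open>The hard forest\<close>

text \<open>\<open>anc_iter\<close> takes its additional step at the top of the chain; reasoning
  from a vertex to its parent needs it at the bottom.\<close>

lemma anc_iter_Suc_shift:
  "anc_iter par (Suc k) x = (case par x of None \<Rightarrow> None | Some y \<Rightarrow> anc_iter par k y)"
proof (induction k)
  case (Suc k)
  then show ?case by (cases "par x") simp_all
qed (simp split: option.split)

lemma in_subtree_rec:
  "in_subtree par u x \<longleftrightarrow> x = u \<or> (\<exists>y. par x = Some y \<and> in_subtree par u y)"
proof
  assume "in_subtree par u x"
  then obtain k where "anc_iter par k x = Some u" by (auto simp: in_subtree_def)
  then show "x = u \<or> (\<exists>y. par x = Some y \<and> in_subtree par u y)"
    by (cases k; cases "par x") (auto simp: in_subtree_def anc_iter_Suc_shift simp del: anc_iter.simps(2))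
next
  assume "x = u \<or> (\<exists>y. par x = Some y \<and> in_subtree par u y)"
  then show "in_subtree par u x"
  proof
    assume "x = u"
    then show ?thesis by (auto simp: in_subtree_def intro!: exI[of _ 0])
  next
    assume "\<exists>y. par x = Some y \<and> in_subtree par u y"
    then obtain y k where "par x = Some y" "anc_iter par k y = Some u"
      by (auto simp: in_subtree_def)
    then have "anc_iter par (Suc k) x = Some u" by (simp only: anc_iter_Suc_shift option.case)
    then show ?thesis unfolding in_subtree_def by blast
  qed
qed

text \<open>A path 0, ..., P - 1 with root P - 1, where every path vertex has s leaf children of weights
  0, ..., s - 1; the remaining vertices are isolated and have weight 0.\<close>

locale spine_forest =
  fixes n P s :: nat
  assumes P_pos: "P > 0" and s_pos: "s > 0" and size: "P + P * s \<le> n"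
begin

definition leaf :: "nat \<Rightarrow> nat \<Rightarrow> nat" where
  "leaf i j = P + i * s + j"

definition leaves :: "nat set" where
  "leaves = {P..<P + P * s}"

definition owner :: "nat \<Rightarrow> nat" where
  "owner v = (v - P) div s"

definition weight :: "nat \<Rightarrow> int" where
  "weight v = (if v \<in> leaves then int ((v - P) mod s) else 0)"

text \<open>All forests reachable by cuts form one family indexed by the set \<open>S\<close> of cut
  vertices, whatever the order of the cuts.\<close>

definition parent :: "nat set \<Rightarrow> nat \<Rightarrow> nat option" where
  "parent S v = (if v \<in> S then None
     else if v < P then (if Suc v < P then Some (Suc v) else None)
     else if v \<in> leaves then Some (owner v) else None)"

lemma owner_leaf [simp]: "j < s \<Longrightarrow> owner (leaf i j) = i"
  by (simp add: owner_def leaf_def)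

lemma leaf_in_leaves: "i < P \<Longrightarrow> j < s \<Longrightarrow> leaf i j \<in> leaves"
proof -
  assume "i < P" "j < s"
  then have "i * s + j < (i + 1) * s" by simp
  also have "\<dots> \<le> P * s" using \<open>i < P\<close> by (intro mult_right_mono) auto
  finally show ?thesis by (simp add: leaf_def leaves_def)
qed

lemma weight_leaf: "i < P \<Longrightarrow> j < s \<Longrightarrow> weight (leaf i j) = int j"
  using leaf_in_leaves by (simp add: weight_def) (simp add: leaf_def)

lemma leaf_eq_iff: "j < s \<Longrightarrow> j' < s \<Longrightarrow> leaf i j = leaf i' j' \<longleftrightarrow> i = i' \<and> j = j'"
  by (metis add_left_cancel leaf_def owner_leaf)

lemma owner_less: "v \<in> leaves \<Longrightarrow> owner v < P"
  using s_pos by (auto simp: leaves_def owner_def less_mult_imp_div_less)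

lemma finite_leaves [simp]: "finite leaves"
  by (simp add: leaves_def)

lemma weight_bounds: "\<bar>weight v\<bar> < int s"
  using s_pos by (simp add: weight_def)

lemma parent_cut: "(parent S)(v := None) = parent (insert v S)"
  by (auto simp: parent_def)

lemma in_subtree_parent_spine:
  assumes "S \<subseteq> leaves" "r < P" "x < P"
  shows "in_subtree (parent S) r x \<longleftrightarrow> x \<le> r"
  using assms(3)
\<comment> \<open>Induction on the distance to the end of the path, since the parent of
  \<open>x\<close> is \<open>Suc x\<close>.\<close>
proof (induction "P - x" arbitrary: x rule: less_induct)
  case less
  have x: "x \<notin> S" using less.prems assms(1) by (auto simp: leaves_def)
  show ?case
  proof (cases "Suc x < P")
    case True
    then have "in_subtree (parent S) r (Suc x) \<longleftrightarrow> Suc x \<le> r"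
      using less.hyps[of "Suc x"] less.prems by simp
    then show ?thesis
      using True x less.prems by (subst in_subtree_rec) (auto simp: parent_def)
  next
    case False
    then show ?thesis
      using x less.prems assms(2) by (subst in_subtree_rec) (auto simp: parent_def)
  qed
qed

lemma in_subtree_parent_iff:
  assumes "S \<subseteq> leaves" "r < P"
  shows "in_subtree (parent S) r x \<longleftrightarrow> x \<le> r \<or> x \<in> leaves - S \<and> owner x \<le> r"
proof (cases "x < P")
  case True
  then show ?thesis
    using in_subtree_parent_spine[OF assms True] by (auto simp: leaves_def)
next
  case False
  then show ?thesis
    using assms in_subtree_parent_spine[OF assms owner_less[of x]]
    by (subst in_subtree_rec) (auto simp: parent_def)
qed

text \<open>Path vertices have weight 0, so only leaves count. The first sum does not depend on
  \<open>S\<close>; a query thus reveals the weight cut off at owners up to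
  \<open>r\<close>.\<close>

lemma subtree_sum_parent:
  assumes "S \<subseteq> leaves" "r < P"
  shows "subtree_sum n (parent S) weight r =
    (\<Sum>x\<in>{x \<in> leaves. owner x \<le> r}. weight x) - (\<Sum>x\<in>{x \<in> S. owner x \<le> r}. weight x)"
proof -
  let ?T = "{x \<in> leaves. owner x \<le> r}" and ?C = "{x \<in> S. owner x \<le> r}"
  have "subtree_sum n (parent S) weight r = (\<Sum>x\<in>{..r} \<union> (?T - ?C). weight x)"
    unfolding subtree_sum_def using assms size
    by (intro sum.cong) (auto simp: in_subtree_parent_iff leaves_def)
  also have "\<dots> = (\<Sum>x\<in>?T - ?C. weight x)"
    using assms by (intro sum.mono_neutral_right) (auto simp: weight_def leaves_def)
  also have "\<dots> = (\<Sum>x\<in>?T. weight x) - (\<Sum>x\<in>?C. weight x)"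
    using assms(1) by (intro sum_diff) auto
  finally show ?thesis .
qed

lemma rooted_forest_parent: "rooted_forest n (parent {})"
proof -
  have root: "parent {} (P - 1) = None"
    using P_pos by (auto simp: parent_def)
  have "\<exists>k. anc_iter (parent {}) k v \<noteq> None \<and> parent {} (the (anc_iter (parent {}) k v)) = None"
    for v
  proof (cases "v < P + P * s")
    case True
    then have "v \<le> P - 1 \<or> v \<in> leaves" by (auto simp: leaves_def)
    then have "in_subtree (parent {}) (P - 1) v"
      using P_pos owner_less[of v] by (subst in_subtree_parent_iff) auto
    then obtain k where "anc_iter (parent {}) k v = Some (P - 1)"
      by (auto simp: in_subtree_def)
    then show ?thesis using root by (intro exI[of _ k]) auto
  next
    case False
    then show ?thesis by (intro exI[of _ 0]) (auto simp: parent_def leaves_def)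
  qed
  moreover have "v < n \<and> p < n" if "parent {} v = Some p" for v p
    using that size owner_less[of v] by (auto simp: parent_def leaves_def split: if_splits)
  ultimately show ?thesis unfolding rooted_forest_def by blast
qed

section \<open>Rounds of cuts and queries\<close>

definition round_ops :: "(nat \<Rightarrow> nat) \<Rightarrow> nat list \<Rightarrow> forest_op list" where
  "round_ops f is = concat (map (\<lambda>i. [Cut (leaf i (f i)), SubtreeSum i]) is)"

definition round_cuts :: "(nat \<Rightarrow> nat) \<Rightarrow> nat set \<Rightarrow> nat set" where
  "round_cuts f I = (\<lambda>i. leaf i (f i)) ` I"

lemma round_ops_simps [simp]:
  "round_ops f [] = []"
  "round_ops f (i # is) = Cut (leaf i (f i)) # SubtreeSum i # round_ops f is"
  "round_ops f (is @ js) = round_ops f is @ round_ops f js"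
  by (simp_all add: round_ops_def)

lemma length_round_ops [simp]: "length (round_ops f is) = 2 * length is"
  by (induction "is") auto

lemma round_ops_cong: "(\<And>i. i \<in> set is \<Longrightarrow> f i = g i) \<Longrightarrow> round_ops f is = round_ops g is"
  by (induction "is") auto

lemma forest_after_round_ops:
  "forest_after (parent S) (round_ops f is) = parent (S \<union> round_cuts f (set is))"
  by (induction "is" arbitrary: S) (auto simp: parent_cut round_cuts_def)

text \<open>Since \<open>leaf i j\<close> has weight \<open>j\<close>, an available number is also
  the amount of weight that its cut removes.\<close>

definition available :: "nat set \<Rightarrow> nat \<Rightarrow> nat set" where
  "available S i = {j. j < s \<and> leaf i j \<notin> S}"

lemma round_cuts_subset:
  "I \<subseteq> {..<P} \<Longrightarrow> (\<And>i. i \<in> I \<Longrightarrow> f i \<in> available S i) \<Longrightarrow> round_cuts f I \<subseteq> leaves"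
  by (auto simp: round_cuts_def available_def intro!: leaf_in_leaves)

lemma available_after_round:
  assumes "i \<notin> I" "\<And>i. i \<in> I \<Longrightarrow> f i \<in> available S i"
  shows "available (S \<union> round_cuts f I) i = available S i"
  using assms by (auto simp: available_def round_cuts_def leaf_eq_iff)

lemma legal_round_ops:
  assumes "distinct is" "set is \<subseteq> {..<P}" "\<And>i. i \<in> set is \<Longrightarrow> f i \<in> available S i"
  shows "legal_ops n (parent S) (round_ops f is)"
  using assms
proof (induction "is" arbitrary: S)
  case (Cons i "is")
  let ?v = "leaf i (f i)"
  have fi: "f i < s" "?v \<notin> S" "i < P" using Cons.prems(2) Cons.prems(3)[of i] by (auto simp: available_def)
  have v: "?v \<in> leaves" using fi by (intro leaf_in_leaves)
  \<comment> \<open>Distinctness of the list makes this cut harmless for the choices at the later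
    path vertices.\<close>
  have "f k \<in> available (insert ?v S) k" if "k \<in> set is" for k
    using Cons.prems(1) Cons.prems(3)[of k] that fi by (auto simp: available_def leaf_eq_iff)
  then have "legal_ops n (parent (insert ?v S)) (round_ops f is)"
    using Cons.prems by (intro Cons.IH) auto
  moreover have "?v < n" "i < n" using v size fi by (auto simp: leaves_def)
  moreover have "parent S ?v \<noteq> None" using v fi by (auto simp: parent_def leaves_def)
  ultimately show ?case by (simp add: parent_cut)
qed auto

text \<open>\<open>T\<close> collects the cuts of the round up to its first query at
  \<open>r\<close>. It is common to both runs because both follow the same choices
  \<open>f\<close>.\<close>

lemma answers_round_ops_eqD:
  assumes "answers n (parent S) weight (round_ops f is) = answers n (parent S') weight (round_ops f is)"
    and "r \<in> set is"
  shows "\<exists>T\<subseteq>round_cuts f (set is).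
    subtree_sum n (parent (S \<union> T)) weight r = subtree_sum n (parent (S' \<union> T)) weight r"
  using assms
proof (induction "is" arbitrary: S S')
  case (Cons i "is")
  let ?v = "leaf i (f i)"
  show ?case
  proof (cases "r = i")
    case True
    then show ?thesis
      using Cons.prems(1) by (intro exI[of _ "{?v}"]) (auto simp: parent_cut round_cuts_def)
  next
    case False
    then have "\<exists>T\<subseteq>round_cuts f (set is). subtree_sum n (parent (insert ?v S \<union> T)) weight r =
        subtree_sum n (parent (insert ?v S' \<union> T)) weight r"
      using Cons.prems by (intro Cons.IH) (auto simp: parent_cut)
    then obtain T where T: "T \<subseteq> round_cuts f (set is)"
      "subtree_sum n (parent (insert ?v S \<union> T)) weight r =
        subtree_sum n (parent (insert ?v S' \<union> T)) weight r" by blast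
    then show ?thesis
      by (intro exI[of _ "insert ?v T"]) (auto simp: round_cuts_def)
  qed
qed auto

text \<open>The cuts in \<open>S\<close> and those of the second half lower both answers at
  \<open>r\<close> equally. What remains is the prefix sum up to \<open>r\<close> of the choices in
  the first half, and the interleaving of the halves recovers the choices from these sums.\<close>

lemma choices_determined_by_answers:
  assumes d: "d > 0" and S: "S \<subseteq> leaves"
    and I: "I = set (bit_rev l c (2 * d))" and J: "J = set (bit_rev l (c + d) (2 * d))"
    and P: "I \<union> J \<subseteq> {..<P}"
    and g: "\<And>i. i \<in> I \<Longrightarrow> g i \<in> available S i"
    and g': "\<And>i. i \<in> I \<Longrightarrow> g' i \<in> available S i"
    and h: "\<And>i. i \<in> J \<Longrightarrow> h i \<in> available S i"
    and eq: "answers n (parent (S \<union> round_cuts g I)) weight (round_ops h (bit_rev l (c + d) (2 * d))) =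
      answers n (parent (S \<union> round_cuts g' I)) weight (round_ops h (bit_rev l (c + d) (2 * d)))"
    and i: "i \<in> I"
  shows "g i = g' i"
proof -
  have disj: "I \<inter> J = {}" unfolding I J by (rule bit_rev_halves_disjoint) fact
  have fin: "finite I" "finite J" by (simp_all add: I J)
  have sums: "subtree_sum n (parent ((S \<union> round_cuts u I) \<union> T)) weight r =
      (\<Sum>x\<in>{x \<in> leaves. owner x \<le> r}. weight x) - (\<Sum>x\<in>{x \<in> S \<union> T. owner x \<le> r}. weight x)
      - int (\<Sum>i\<in>{i \<in> I. i \<le> r}. u i)"
    if T: "T \<subseteq> round_cuts h J" and r: "r \<in> J" and u: "\<And>i. i \<in> I \<Longrightarrow> u i \<in> available S i" for T r u
  proof -
    have rP: "r < P" using r P by auto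
    have TL: "T \<subseteq> leaves" using T round_cuts_subset[of J h S] P h by auto
    have UL: "round_cuts u I \<subseteq> leaves" using round_cuts_subset[of I u S] P u by auto
    have us: "u i < s" "leaf i (u i) \<notin> S" if "i \<in> I" for i
      using u[OF that] by (auto simp: available_def)
    have "{x \<in> (S \<union> round_cuts u I) \<union> T. owner x \<le> r} =
        {x \<in> S \<union> T. owner x \<le> r} \<union> (\<lambda>i. leaf i (u i)) ` {i \<in> I. i \<le> r}"
      using us by (auto simp: round_cuts_def)
    \<comment> \<open>A leaf cut in the first half is outside \<open>S\<close> by availability and
      outside \<open>T\<close> because its owner is not in \<open>J\<close>; hence the weights add
      up.\<close>
    moreover have "x \<notin> S \<union> T" if x: "x \<in> (\<lambda>i. leaf i (u i)) ` {i \<in> I. i \<le> r}" for x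
    proof
      obtain i where i: "i \<in> I" "x = leaf i (u i)" using x by auto
      assume "x \<in> S \<union> T"
      then have "x \<in> round_cuts h J" using us(2)[OF i(1)] i T by auto
      then obtain k where k: "k \<in> J" "x = leaf k (h k)" by (auto simp: round_cuts_def)
      then have "i = k" using i us(1)[OF i(1)] h[OF k(1)] by (auto simp: available_def leaf_eq_iff)
      then show False using i k disj by auto
    qed
    moreover have "finite (S \<union> T)" using S TL finite_subset finite_leaves by blast
    ultimately have "(\<Sum>x\<in>{x \<in> (S \<union> round_cuts u I) \<union> T. owner x \<le> r}. weight x) =
        (\<Sum>x\<in>{x \<in> S \<union> T. owner x \<le> r}. weight x) + (\<Sum>x\<in>(\<lambda>i. leaf i (u i)) ` {i \<in> I. i \<le> r}. weight x)"
      using fin by (simp only:) (intro sum.union_disjoint; auto)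
    also have "(\<Sum>x\<in>(\<lambda>i. leaf i (u i)) ` {i \<in> I. i \<le> r}. weight x) =
        (\<Sum>i\<in>{i \<in> I. i \<le> r}. weight (leaf i (u i)))"
      using us by (subst sum.reindex) (auto simp: inj_on_def leaf_eq_iff)
    also have "\<dots> = int (\<Sum>i\<in>{i \<in> I. i \<le> r}. u i)"
      unfolding of_nat_sum using us P by (intro sum.cong) (auto intro!: weight_leaf)
    finally show ?thesis
      using subtree_sum_parent[of "(S \<union> round_cuts u I) \<union> T" r] S TL UL rP by simp
  qed
  show ?thesis
  proof (rule bit_rev_prefix_sums_determine[OF d _ i[unfolded I]])
    fix r assume r: "r \<in> set (bit_rev l (c + d) (2 * d))"
    from answers_round_ops_eqD[OF eq r] obtain T where T: "T \<subseteq> round_cuts h J"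
      "subtree_sum n (parent ((S \<union> round_cuts g I) \<union> T)) weight r =
       subtree_sum n (parent ((S \<union> round_cuts g' I) \<union> T)) weight r"
      unfolding J by blast
    have "r \<in> J" using r J by simp
    from T(2) sums[OF T(1) this g] sums[OF T(1) this g']
    show "(\<Sum>i\<in>{i \<in> set (bit_rev l c (2 * d)). i \<le> r}. g i) =
        (\<Sum>i\<in>{i \<in> set (bit_rev l c (2 * d)). i \<le> r}. g' i)"
      unfolding I[symmetric] by linarith
  qed
qed

end

section \<open>Information transfer\<close>

locale spine_forest_ds = spine_forest +
  fixes D :: ds and w :: nat
  assumes wf_progs: "v < n \<Longrightarrow> wf_prog w (cut_prog D n v) \<and> wf_prog w (query_prog D n v)"
begin

text \<open>Correctness as a property of a memory state, covering all legal continuations. In this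
  form it survives a round, and the argument can start anew from any later memory.\<close>

definition consistent :: "(nat \<Rightarrow> nat) \<Rightarrow> nat set \<Rightarrow> bool" where
  "consistent m S \<longleftrightarrow> (\<forall>a. m a < 2 ^ w) \<and>
     (\<forall>ops. legal_ops n (parent S) ops \<longrightarrow>
        result (seq_prog D n ops) m = answers n (parent S) weight ops)"

lemma wf_seq_prog: "legal_ops n par ops \<Longrightarrow> wf_prog w (seq_prog D n ops)"
proof (induction ops arbitrary: par)
  case (Cons x ops)
  then show ?case
    using wf_progs by (cases x) (auto intro!: wf_bind_prog simp del: fun_upd_apply)
qed simp

abbreviation round_prog :: "(nat \<Rightarrow> nat) \<Rightarrow> nat list \<Rightarrow> int option list prog" where
  "round_prog f is \<equiv> seq_prog D n (round_ops f is)"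

text \<open>A legal continuation after the round, prefixed by the round, is a legal continuation
  before it.\<close>

lemma consistent_after_round:
  assumes "consistent m S" "distinct is" "set is \<subseteq> {..<P}" "\<And>i. i \<in> set is \<Longrightarrow> f i \<in> available S i"
  shows "consistent (final_mem (round_prog f is) m) (S \<union> round_cuts f (set is))"
proof -
  have legal: "legal_ops n (parent S) (round_ops f is)"
    using assms by (intro legal_round_ops)
  have "result (seq_prog D n ops) (final_mem (round_prog f is) m) =
      answers n (parent (S \<union> round_cuts f (set is))) weight ops"
    if "legal_ops n (parent (S \<union> round_cuts f (set is))) ops" for ops
  proof -
    have "legal_ops n (parent S) (round_ops f is @ ops)"
      using legal that by (simp add: legal_ops_append forest_after_round_ops)
    then have "result (seq_prog D n (round_ops f is @ ops)) m =
        answers n (parent S) weight (round_ops f is @ ops)"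
      using assms(1) unfolding consistent_def by blast
    then show ?thesis
      by (simp add: answers_append forest_after_round_ops)
  qed
  moreover have "final_mem (round_prog f is) m a < 2 ^ w" for a
    using wf_prog_bounds(2)[OF wf_seq_prog[OF legal]] assms(1) unfolding consistent_def by blast
  ultimately show ?thesis unfolding consistent_def by blast
qed

text \<open>The information transfer at a node of the bisection tree. Cells that the second half
  overwrites before reading carry no information and are excluded by
  \<open>exposed_reads\<close>.\<close>

definition transfer :: "(nat \<Rightarrow> nat) \<Rightarrow> (nat \<Rightarrow> nat) \<Rightarrow> nat list \<Rightarrow> (nat \<Rightarrow> nat) \<Rightarrow> nat list \<Rightarrow> nat set" where
  "transfer m g is h js =
     exposed_reads (round_prog h js) (final_mem (round_prog g is) m) \<inter> written (round_prog g is) m"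

text \<open>The transferred cells and their contents, together with the memory before the first half,
  suffice to simulate the second half.\<close>

lemma result_determined_by_transfer:
  assumes X: "X = (\<lambda>a. (a, final_mem (round_prog g is) m a)) ` transfer m g is h js"
  shows "result (round_prog h js) (final_mem (round_prog g is) m) =
    result (round_prog h js) (\<lambda>a. if a \<in> fst ` X then (THE b. (a, b) \<in> X) else m a)"
proof (rule result_cong_exposed_reads)
  fix a assume a: "a \<in> exposed_reads (round_prog h js) (final_mem (round_prog g is) m)"
  show "final_mem (round_prog g is) m a = (if a \<in> fst ` X then (THE b. (a, b) \<in> X) else m a)"
  proof (cases "a \<in> written (round_prog g is) m")
    case True
    then have "a \<in> transfer m g is h js" using a by (simp add: transfer_def)
    \<comment> \<open>\<open>X\<close> is the graph of a function, so \<open>THE\<close> decodes the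
      transferred content.\<close>
    then have "(a, b) \<in> X \<longleftrightarrow> b = final_mem (round_prog g is) m a" for b
      unfolding X by auto
    moreover from this have "a \<in> fst ` X" by force
    ultimately show ?thesis by simp
  next
    case False
    then have "a \<notin> fst ` X" by (auto simp: X transfer_def)
    then show ?thesis using False by (simp add: final_mem_not_written)
  qed
qed

text \<open>For fixed \<open>m\<close> and \<open>h\<close>, the transferred cells with their
  contents determine the answers of the second half and hence \<open>g\<close>. By the assumption on
  \<open>q\<close>, the choices at \<open>2 ^ e\<close> path vertices outnumber the address-content
  pairs, so encoding \<open>g\<close> takes at least \<open>2 ^ (l - e) / 2\<close> cells on
  average.\<close>

lemma sum_transfer_ge:
  assumes cons: "consistent m S" and S: "S \<subseteq> leaves" and d: "d > 0"
    and is_def: "is = bit_rev l c (2 * d)" and js_def: "js = bit_rev l (c + d) (2 * d)"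
    and P: "set is \<union> set js \<subseteq> {..<P}"
    and A: "\<And>i. i \<in> set is \<Longrightarrow> A i \<subseteq> available S i \<and> card (A i) = q"
    and h: "\<And>i. i \<in> set js \<Longrightarrow> h i \<in> available S i"
    and q: "2 * (4 ^ w + 1) \<le> q ^ (2 ^ e)" and e: "e \<le> l"
  shows "2 ^ (l - e) * q ^ (2 ^ l) \<le> 2 * (\<Sum>g\<in>PiE (set is) A. card (transfer m g is h js))"
proof -
  let ?X = "PiE (set is) A"
  let ?U = "{..<2 ^ w} \<times> {..<2 ^ w} :: (nat \<times> nat) set"
  define M where "M = (\<lambda>g. (\<lambda>a. (a, final_mem (round_prog g is) m a)) ` transfer m g is h js)"
  have finA: "finite (A i)" if "i \<in> set is" for i
    using A[OF that] finite_subset[of "A i" "{..<s}"] by (auto simp: available_def)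
  have dist: "distinct is" "distinct js" using d by (simp_all add: is_def js_def distinct_bit_rev)
  have disj: "set is \<inter> set js = {}"
    unfolding is_def js_def by (rule bit_rev_halves_disjoint) fact
  have avail: "g i \<in> available S i" if "g \<in> ?X" "i \<in> set is" for g i
    using that A by (auto dest: PiE_mem)
  have cons': "consistent (final_mem (round_prog g is) m) (S \<union> round_cuts g (set is))"
    if "g \<in> ?X" for g
    using cons dist P avail[OF that] by (intro consistent_after_round) auto
  have legal: "legal_ops n (parent (S \<union> round_cuts g (set is))) (round_ops h js)" if "g \<in> ?X" for g
  proof (rule legal_round_ops)
    show "h i \<in> available (S \<union> round_cuts g (set is)) i" if i: "i \<in> set js" for i
      using available_after_round[of i "set is" g S] avail[OF \<open>g \<in> ?X\<close>] disj h[OF i] i by auto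
  qed (use dist P in auto)
  have cardX: "card ?X = q ^ (2 ^ l)"
    using A d by (simp add: card_PiE is_def card_set_bit_rev)
  have "inj_on M ?X"
  proof (rule inj_onI)
    fix g g' assume g: "g \<in> ?X" and g': "g' \<in> ?X" and eq: "M g = M g'"
    have "result (round_prog h js) (final_mem (round_prog u is) m) =
        result (round_prog h js) (\<lambda>a. if a \<in> fst ` M u then (THE b. (a, b) \<in> M u) else m a)" for u
      by (rule result_determined_by_transfer) (simp only: M_def)
    from this[of g, unfolded eq] this[of g']
    have "result (round_prog h js) (final_mem (round_prog g is) m) =
        result (round_prog h js) (final_mem (round_prog g' is) m)"
      by simp
    then have "answers n (parent (S \<union> round_cuts g (set is))) weight (round_ops h js) =
        answers n (parent (S \<union> round_cuts g' (set is))) weight (round_ops h js)"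
      using cons'[OF g] cons'[OF g'] legal[OF g] legal[OF g'] unfolding consistent_def by auto
    then have "g i = g' i" if "i \<in> set is" for i
      using choices_determined_by_answers[OF d S _ _ _ avail[OF g] avail[OF g'] h _ that, of l c]
        P is_def js_def by simp
    then show "g = g'" using g g' by (intro PiE_ext) auto
  qed
  moreover have "M g \<subseteq> ?U" if "g \<in> ?X" for g
  proof -
    have bound: "final_mem (round_prog g is) m a < 2 ^ w" for a
      using cons'[OF that] by (simp add: consistent_def)
    have "exposed_reads (round_prog h js) (final_mem (round_prog g is) m) \<subseteq> {..<2 ^ w}"
      by (rule wf_prog_bounds(1)[OF wf_seq_prog[OF legal[OF that]] bound])
    then show ?thesis using bound by (auto simp: M_def transfer_def)
  qed
  moreover have "2 * (card ?U + 1) ^ (2 ^ (l - e)) \<le> card ?X"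
  proof -
    have "card ?U = 4 ^ w"
      by (simp add: card_cartesian_product flip: power_mult_distrib)
    \<comment> \<open>There are \<open>4 ^ w\<close> pairs of an address and a content. The factor 2
      required by the encoding argument is absorbed into the base of the power.\<close>
    moreover have "(2 :: nat) * (4 ^ w + 1) ^ (2 ^ (l - e)) \<le> (2 * (4 ^ w + 1)) ^ (2 ^ (l - e))"
      unfolding power_mult_distrib by (intro mult_right_mono self_le_power) auto
    moreover have "\<dots> \<le> (q ^ (2 ^ e)) ^ (2 ^ (l - e))"
      using q by (intro power_mono) auto
    moreover have "\<dots> = q ^ (2 ^ l)"
      using e by (simp flip: power_mult power_add)
    ultimately show ?thesis unfolding cardX by simp
  qed
  ultimately have "2 ^ (l - e) * card ?X \<le> 2 * (\<Sum>g\<in>?X. card (M g))"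
    using finA by (intro sum_card_ge_of_inj_on[where U = ?U]) (auto intro!: finite_PiE)
  moreover have "card (M g) = card (transfer m g is h js)" for g
    unfolding M_def by (intro card_image) (auto simp: inj_on_def)
  ultimately show ?thesis by (simp add: cardX)
qed

text \<open>Averaging over all choices: each block costs the exposed reads, plus the information transfer
  at every level of its recursive bisection.\<close>

lemma block_cost:
  assumes "consistent m S" "S \<subseteq> leaves" "d > 0" "set (bit_rev l c d) \<subseteq> {..<P}"
    and "\<And>i. i \<in> set (bit_rev l c d) \<Longrightarrow> A i \<subseteq> available S i \<and> card (A i) = q"
    and q: "2 * (4 ^ w + 1) \<le> q ^ (2 ^ e)"
  shows "2 ^ (e + 2) * (\<Sum>f\<in>PiE (set (bit_rev l c d)) A.
        card (exposed_reads (round_prog f (bit_rev l c d)) m)) + q ^ (2 ^ l) * ((l - e) * 2 ^ l)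
    \<le> 2 ^ (e + 2) * (\<Sum>f\<in>PiE (set (bit_rev l c d)) A. cost (round_prog f (bit_rev l c d)) m)"
  using assms(1-5)
proof (induction l arbitrary: c d m S)
  case 0
  show ?case
    by (simp only: diff_0_eq_0 mult_0 mult_0_right add_0_right)
      (intro mult_le_mono2 sum_mono card_exposed_reads_le_cost)
next
  case (Suc l)
  define xs ys where "xs = bit_rev l c (2 * d)" and "ys = bit_rev l (c + d) (2 * d)"
  have split: "bit_rev (Suc l) c d = xs @ ys" by (simp add: xs_def ys_def)
  let ?I = "PiE (set xs) A" and ?J = "PiE (set ys) A"
  let ?Q = "q ^ (2 ^ l)"
  let ?m = "\<lambda>g. final_mem (round_prog g xs) m"
  let ?K = "2 ^ (e + 2) :: nat"
  have P: "set xs \<union> set ys \<subseteq> {..<P}" using Suc.prems(4) unfolding split by simp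
  have A: "A i \<subseteq> available S i" "card (A i) = q" if "i \<in> set xs \<union> set ys" for i
    using Suc.prems(5)[of i] that unfolding split by auto
  have d: "2 * d > 0" using Suc.prems(3) by simp
  have disj: "set xs \<inter> set ys = {}"
    unfolding xs_def ys_def using Suc.prems(3) by (rule bit_rev_halves_disjoint)
  have dist: "distinct xs" using d by (simp add: xs_def distinct_bit_rev)
  have cardI: "card ?I = ?Q" and cardJ: "card ?J = ?Q"
    using A d by (simp_all add: card_PiE xs_def ys_def card_set_bit_rev)
  have avail: "f i \<in> available S i" if "f \<in> PiE T A" "i \<in> T" "T \<subseteq> set xs \<union> set ys" for f T i
    using that A by (auto dest: PiE_mem)
  \<comment> \<open>Stated for functions of operation lists, because programs depend on the choices
    only through these lists.\<close>
  have sum_split: "(\<Sum>f\<in>PiE (set (xs @ ys)) A. F (round_ops f (xs @ ys))) =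
      (\<Sum>g\<in>?I. \<Sum>h\<in>?J. F (round_ops g xs @ round_ops h ys))" for F :: "forest_op list \<Rightarrow> nat"
  proof -
    have "round_ops (\<lambda>i. if i \<in> set xs then g i else h i) (xs @ ys) = round_ops g xs @ round_ops h ys" for g h
      using disj by (auto intro!: arg_cong2[where f = "(@)"] round_ops_cong)
    then show ?thesis using disj by (simp only: set_append sum_PiE_Un)
  qed
  have left: "?K * (\<Sum>g\<in>?I. card (exposed_reads (round_prog g xs) m)) + ?Q * ((l - e) * 2 ^ l)
      \<le> ?K * (\<Sum>g\<in>?I. cost (round_prog g xs) m)"
    unfolding xs_def using Suc.prems(1,2) d P A xs_def by (intro Suc.IH) auto
  \<comment> \<open>For each \<open>g\<close> the induction hypothesis is applied to the memory and
    the cut set that \<open>g\<close> leaves behind; this is why \<open>m\<close> and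
    \<open>S\<close> vary in the induction.\<close>
  have right: "?K * (\<Sum>h\<in>?J. card (exposed_reads (round_prog h ys) (?m g))) + ?Q * ((l - e) * 2 ^ l)
      \<le> ?K * (\<Sum>h\<in>?J. cost (round_prog h ys) (?m g))" if g: "g \<in> ?I" for g
    unfolding ys_def
  proof (rule Suc.IH)
    note avail_g = avail[OF g, simplified]
    show "consistent (?m g) (S \<union> round_cuts g (set xs))"
      using Suc.prems(1) dist P avail_g by (intro consistent_after_round) auto
    show "S \<union> round_cuts g (set xs) \<subseteq> leaves"
      using Suc.prems(2) round_cuts_subset[of "set xs" g S] P avail_g by auto
    show "A i \<subseteq> available (S \<union> round_cuts g (set xs)) i \<and> card (A i) = q"
      if "i \<in> set (bit_rev l (c + d) (2 * d))" for i
      using that A[of i] disj available_after_round[of i "set xs" g S] avail_g unfolding ys_def by auto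
  qed (use d P ys_def in auto)
  \<comment> \<open>The truncated difference \<open>Suc l - e - (l - e)\<close> is 1 if
    \<open>e \<le> l\<close> and 0 otherwise: levels too small for the encoding argument claim no
    transfer.\<close>
  have mid: "?Q * ?Q * ((Suc l - e - (l - e)) * 2 ^ Suc l)
      \<le> ?K * (\<Sum>g\<in>?I. \<Sum>h\<in>?J. card (transfer m g xs h ys))"
  proof (cases "e \<le> l")
    case True
    have "(\<Sum>h\<in>?J. 2 ^ (l - e) * ?Q) \<le> (\<Sum>h\<in>?J. 2 * (\<Sum>g\<in>?I. card (transfer m g xs h ys)))"
    proof (rule sum_mono)
      fix h assume h: "h \<in> ?J"
      show "2 ^ (l - e) * ?Q \<le> 2 * (\<Sum>g\<in>?I. card (transfer m g xs h ys))"
        using A P avail[OF h]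
        by (intro sum_transfer_ge[OF Suc.prems(1,2,3) xs_def ys_def _ _ _ q True]) auto
    qed
    then have "?Q * (2 ^ (l - e) * ?Q) \<le> 2 * (\<Sum>g\<in>?I. \<Sum>h\<in>?J. card (transfer m g xs h ys))"
      unfolding sum_distrib_left[symmetric] by (subst sum.swap) (simp add: cardJ mult.left_commute)
    \<comment> \<open>The factor \<open>2 ^ (e + 1)\<close> turns \<open>2 ^ (l - e)\<close> into
      the block length \<open>2 ^ Suc l\<close>; with the remaining 2 it gives the constant
      \<open>2 ^ (e + 2)\<close>.\<close>
    then have "2 ^ (e + 1) * (?Q * (2 ^ (l - e) * ?Q))
        \<le> 2 ^ (e + 1) * (2 * (\<Sum>g\<in>?I. \<Sum>h\<in>?J. card (transfer m g xs h ys)))"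
      by (rule mult_le_mono2)
    moreover have "2 ^ (e + 1) * (?Q * (2 ^ (l - e) * ?Q)) = ?Q * ?Q * 2 ^ Suc l"
    proof -
      have "2 ^ Suc l = 2 ^ (e + 1) * (2 ^ (l - e) :: nat)"
        using True by (simp flip: power_add)
      then show ?thesis by (simp only: mult_ac)
    qed
    moreover have "Suc l - e - (l - e) = 1" using True by simp
    moreover have "2 ^ (e + 1) * (2 * t) = ?K * t" for t :: nat by simp
    ultimately show ?thesis by (simp only: mult_1)
  next
    case False
    then have "Suc l - e = 0" by simp
    then show ?thesis by simp
  qed
  \<comment> \<open>A transferred cell is exposed in the second half but is covered by a write of
    the first half, so joining the halves loses it. The loss is what this level of the bisection
    gains.\<close>
  have reads: "card (exposed_reads (seq_prog D n (round_ops g xs @ round_ops h ys)) m) +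
      card (transfer m g xs h ys)
      \<le> card (exposed_reads (round_prog g xs) m) + card (exposed_reads (round_prog h ys) (?m g))" for g h
  proof -
    let ?R = "exposed_reads (round_prog h ys) (?m g)" and ?W = "written (round_prog g xs) m"
    have "card ?R = card (?R - ?W) + card (?R \<inter> ?W)"
      by (subst card_Un_disjoint[symmetric]) (auto intro!: arg_cong[where f = card])
    moreover have "card (exposed_reads (round_prog g xs) m \<union> (?R - ?W))
        \<le> card (exposed_reads (round_prog g xs) m) + card (?R - ?W)"
      by (rule card_Un_le)
    ultimately show ?thesis by (simp add: transfer_def)
  qed
  let ?E = "\<Sum>g\<in>?I. \<Sum>h\<in>?J. card (exposed_reads (seq_prog D n (round_ops g xs @ round_ops h ys)) m)"
  let ?T = "\<Sum>g\<in>?I. \<Sum>h\<in>?J. card (transfer m g xs h ys)"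
  let ?L = "\<Sum>g\<in>?I. card (exposed_reads (round_prog g xs) m)"
  let ?R = "\<Sum>g\<in>?I. \<Sum>h\<in>?J. card (exposed_reads (round_prog h ys) (?m g))"
  let ?b = "(l - e) * 2 ^ l"
  have "?E + ?T \<le> ?Q * ?L + ?R"
  proof -
    have "?E + ?T \<le> (\<Sum>g\<in>?I. \<Sum>h\<in>?J. card (exposed_reads (round_prog g xs) m) +
        card (exposed_reads (round_prog h ys) (?m g)))"
      unfolding sum.distrib[symmetric] by (intro sum_mono reads)
    then show ?thesis by (simp add: sum.distrib cardJ sum_distrib_left)
  qed
  moreover have "k * a + k * b \<le> q' * (k * c) + k * d" if "a + b \<le> q' * c + d" for a b c d k q' :: nat
    using mult_le_mono2[OF that, of k] by (simp add: algebra_simps)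
  ultimately have 1: "?K * ?E + ?K * ?T \<le> ?Q * (?K * ?L) + ?K * ?R" by blast
  have 2: "?Q * (?K * ?L) + ?Q * ?Q * ?b \<le> ?Q * (?K * (\<Sum>g\<in>?I. cost (round_prog g xs) m))"
    using mult_le_mono2[OF left, of ?Q] by (simp add: algebra_simps)
  have 3: "?K * ?R + ?Q * ?Q * ?b \<le> ?K * (\<Sum>g\<in>?I. \<Sum>h\<in>?J. cost (round_prog h ys) (?m g))"
  proof -
    have "(\<Sum>g\<in>?I. ?K * (\<Sum>h\<in>?J. card (exposed_reads (round_prog h ys) (?m g))) + ?Q * ?b)
        \<le> (\<Sum>g\<in>?I. ?K * (\<Sum>h\<in>?J. cost (round_prog h ys) (?m g)))"
      by (rule sum_mono) (rule right)
    then show ?thesis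
      by (simp only: sum.distrib sum_distrib_left[symmetric] sum_constant cardI of_nat_id mult_ac)
  qed
  \<comment> \<open>Both halves contribute their levels, and the current level adds at most
    one.\<close>
  have 4: "?Q * ?Q * ?b + ?Q * ?Q * ?b + ?Q * ?Q * ((Suc l - e - (l - e)) * 2 ^ Suc l) =
      q ^ (2 ^ Suc l) * ((Suc l - e) * 2 ^ Suc l)"
  proof -
    have "q ^ (2 ^ Suc l) = ?Q * ?Q" by (simp add: mult_2 power_add)
    moreover have "?b + ?b + (Suc l - e - (l - e)) * 2 ^ Suc l = (Suc l - e) * 2 ^ Suc l"
      by (cases "e \<le> l") (simp_all add: Suc_diff_le)
    ultimately show ?thesis by (metis add_mult_distrib2)
  qed
  have "?K * ?E + q ^ (2 ^ Suc l) * ((Suc l - e) * 2 ^ Suc l)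
      \<le> ?Q * (?K * (\<Sum>g\<in>?I. cost (round_prog g xs) m)) +
        ?K * (\<Sum>g\<in>?I. \<Sum>h\<in>?J. cost (round_prog h ys) (?m g))"
    using 1 2 3 mid 4 by linarith
  also have "\<dots> = ?K * (\<Sum>g\<in>?I. \<Sum>h\<in>?J. cost (seq_prog D n (round_ops g xs @ round_ops h ys)) m)"
    by (simp add: sum.distrib cardJ sum_distrib_left algebra_simps)
  finally show ?case
    unfolding split sum_split[of "\<lambda>ops. card (exposed_reads (seq_prog D n ops) m)"]
      sum_split[of "\<lambda>ops. cost (seq_prog D n ops) m"] .
qed

section \<open>Rounds\<close>

text \<open>\<open>block_cost\<close> bounds an average over choices, so some choice reaches the
  bound.\<close>

lemma expensive_round:
  assumes "consistent m S" "S \<subseteq> leaves" and Pp: "P = 2 ^ p" and "q > 0"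
    and A: "\<And>i. i < P \<Longrightarrow> q \<le> card (available S i)"
    and q: "2 * (4 ^ w + 1) \<le> q ^ (2 ^ e)"
  shows "\<exists>f. (\<forall>i<P. f i \<in> available S i) \<and>
    (p - e) * 2 ^ p \<le> 2 ^ (e + 2) * cost (round_prog f (bit_rev p 0 1)) m"
proof -
  have set: "set (bit_rev p 0 1) = {..<P}" by (simp add: set_bit_rev Pp)
  \<comment> \<open>Trimming to exactly \<open>q\<close> numbers at each path vertex makes the count
    of choice functions equal to \<open>q ^ (2 ^ p)\<close>.\<close>
  have "\<exists>B. B \<subseteq> available S i \<and> card B = q" if "i < P" for i
    using obtain_subset_with_card_n[OF A[OF that]] by metis
  then obtain A where A: "\<And>i. i < P \<Longrightarrow> A i \<subseteq> available S i \<and> card (A i) = q"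
    by metis
  have cardX: "card (PiE {..<P} A) = q ^ (2 ^ p)"
    using A by (simp add: card_PiE Pp)
  have "q ^ (2 ^ p) * ((p - e) * 2 ^ p)
      \<le> 2 ^ (e + 2) * (\<Sum>f\<in>PiE {..<P} A. cost (round_prog f (bit_rev p 0 1)) m)"
    using block_cost[of m S 1 p 0 A q e] assms(1,2) A q unfolding set by auto
  then have le: "(\<Sum>f\<in>PiE {..<P} A. (p - e) * 2 ^ p)
      \<le> (\<Sum>f\<in>PiE {..<P} A. 2 ^ (e + 2) * cost (round_prog f (bit_rev p 0 1)) m)"
    by (simp only: sum_distrib_left sum_constant cardX of_nat_id)
  have "\<exists>f\<in>PiE {..<P} A. (p - e) * 2 ^ p \<le> 2 ^ (e + 2) * cost (round_prog f (bit_rev p 0 1)) m"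
  proof (rule ccontr)
    assume neg: "\<not> ?thesis"
    have "PiE {..<P} A \<noteq> {}" "finite (PiE {..<P} A)"
      using cardX \<open>q > 0\<close> by (metis card.empty power_eq_0_iff less_irrefl, metis card.infinite power_eq_0_iff less_irrefl)
    then have "(\<Sum>f\<in>PiE {..<P} A. 2 ^ (e + 2) * cost (round_prog f (bit_rev p 0 1)) m)
        < (\<Sum>f\<in>PiE {..<P} A. (p - e) * 2 ^ p)"
      using neg by (intro sum_strict_mono) (auto simp: not_le)
    then show False using le by linarith
  qed
  then obtain f where f: "f \<in> PiE {..<P} A"
    "(p - e) * 2 ^ p \<le> 2 ^ (e + 2) * cost (round_prog f (bit_rev p 0 1)) m" by blast
  then have "\<forall>i<P. f i \<in> available S i" using A by (auto dest: PiE_mem)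
  then show ?thesis using f(2) by blast
qed

text \<open>Each round uses up one leaf per path vertex. Starting with \<open>2 * q\<close> leaves
  keeps at least \<open>q\<close> available in each of the first \<open>q\<close> rounds, and each
  round is chosen against the memory left by the previous ones.\<close>

lemma expensive_rounds:
  assumes "consistent m {}" and Pp: "P = 2 ^ p" and sq: "s = 2 * q" and "q > 0"
    and q: "2 * (4 ^ w + 1) \<le> q ^ (2 ^ e)" and "k \<le> q"
  shows "\<exists>ops S. legal_ops n (parent {}) ops \<and> length ops = 2 * 2 ^ p * k \<and>
    forest_after (parent {}) ops = parent S \<and> S \<subseteq> leaves \<and>
    (\<forall>i<P. card (available S i) = 2 * q - k) \<and> consistent (final_mem (seq_prog D n ops) m) S \<and>
    k * ((p - e) * 2 ^ p) \<le> 2 ^ (e + 2) * cost (seq_prog D n ops) m"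
  using \<open>k \<le> q\<close>
proof (induction k)
  case 0
  have "available {} i = {..<s}" for i by (auto simp: available_def)
  then have "card (available {} i) = 2 * q" for i by (simp add: sq)
  then show ?case
    using assms(1) by (intro exI[of _ "[]"] exI[of _ "{}"]) simp
next
  case (Suc k)
  then obtain ops S where IH: "legal_ops n (parent {}) ops" "length ops = 2 * 2 ^ p * k"
    "forest_after (parent {}) ops = parent S" "S \<subseteq> leaves"
    "\<And>i. i < P \<Longrightarrow> card (available S i) = 2 * q - k"
    "consistent (final_mem (seq_prog D n ops) m) S"
    "k * ((p - e) * 2 ^ p) \<le> 2 ^ (e + 2) * cost (seq_prog D n ops) m"
    by auto
  let ?m = "final_mem (seq_prog D n ops) m" and ?is = "bit_rev p 0 1"
  have set: "set ?is = {..<P}" by (simp add: set_bit_rev Pp)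
  obtain f where f: "\<And>i. i < P \<Longrightarrow> f i \<in> available S i"
    "(p - e) * 2 ^ p \<le> 2 ^ (e + 2) * cost (round_prog f ?is) ?m"
  proof -
    have "q \<le> card (available S i)" if "i < P" for i
      using IH(5)[OF that] Suc.prems by simp
    from expensive_round[OF IH(6,4) Pp \<open>q > 0\<close> this q] that show ?thesis by blast
  qed
  have dist: "distinct ?is" by (simp add: distinct_bit_rev)
  let ?S = "S \<union> round_cuts f {..<P}"
  have "legal_ops n (parent S) (round_ops f ?is)"
    using f(1) dist set by (intro legal_round_ops) auto
  moreover have "?S \<subseteq> leaves"
    using IH(4) round_cuts_subset[of "{..<P}" f S] f(1) by auto
  moreover have "card (available ?S i) = 2 * q - Suc k" if "i < P" for i
  proof -
    have "available ?S i = available S i - {f i}"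
      using f(1) that by (auto simp: available_def round_cuts_def leaf_eq_iff)
    then show ?thesis using f(1)[OF that] IH(5)[OF that] by simp
  qed
  moreover have "consistent (final_mem (round_prog f ?is) ?m) ?S"
    using consistent_after_round[OF IH(6) dist, of f] f(1) set by auto
  ultimately show ?case
    using IH(1-3,7) f(2) set
    by (intro exI[of _ "ops @ round_ops f ?is"] exI[of _ ?S])
      (auto simp: legal_ops_append forest_after_append forest_after_round_ops algebra_simps)
qed

end

section \<open>Choice of parameters and conclusion\<close>

lemma ex_expensive_sequence:
  fixes D :: ds
  assumes correct: "ds_correct w D" and b: "b + 1 \<le> w n" and q: "2 * (4 ^ w n + 1) \<le> ((2 :: nat) ^ b) ^ (2 ^ e)"
    and size: "2 ^ p + 2 ^ p * (2 * 2 ^ b) \<le> n"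
  shows "\<exists>par wt ops. rooted_forest n par \<and> (\<forall>x<n. \<bar>wt x\<bar> < 2 ^ w n) \<and> length ops = n \<and>
    legal_ops n par ops \<and>
    2 ^ b * ((p - e) * 2 ^ p) \<le> 2 ^ (e + 2) * snd (run_seq D n (ds_init D n par wt) ops)"
proof -
  interpret spine_forest_ds n "2 ^ p" "2 * 2 ^ b" D "w n"
    using correct size by unfold_locales (auto simp: ds_correct_def)
  let ?m = "ds_init D n (parent {}) weight"
  \<comment> \<open>The weights are below the number \<open>2 * 2 ^ b\<close> of leaves per path
    vertex, so \<open>b + 1 \<le> w n\<close> makes them fit into a word.\<close>
  have "(2 :: int) * 2 ^ b \<le> 2 ^ w n"
    using power_increasing[OF b, of "2 :: int"] by simp
  then have wt: "\<bar>weight x\<bar> < 2 ^ w n" for x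
    using weight_bounds[of x] by simp
  have "consistent ?m {}"
    using correct wt rooted_forest_parent unfolding ds_correct_def consistent_def run_seq_eq by simp
  from expensive_rounds[OF this refl refl _ q, of "2 ^ b"]
  obtain ops where ops: "legal_ops n (parent {}) ops" "length ops = 2 * 2 ^ p * 2 ^ b"
    "2 ^ b * ((p - e) * 2 ^ p) \<le> 2 ^ (e + 2) * cost (seq_prog D n ops) ?m" by auto
  have len: "length ops \<le> n" using size ops(2) by (simp add: algebra_simps)
  have "n > 0" using size by (metis add_is_0 le_zero_eq neq0_conv power_eq_0_iff zero_neq_numeral)
  then have pad: "legal_ops n par (replicate k (SubtreeSum 0))" for par k
    by (induction k) auto
  \<comment> \<open>Queries at vertex 0 are always legal; they bring the length to exactly
    \<open>n\<close> and cannot lower the cost.\<close>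
  let ?ops = "ops @ replicate (n - length ops) (SubtreeSum 0)"
  have "length ?ops = n" using len by simp
  moreover have "legal_ops n (parent {}) ?ops"
    using ops(1) pad by (simp add: legal_ops_append)
  moreover have "2 ^ b * ((p - e) * 2 ^ p) \<le> 2 ^ (e + 2) * snd (run_seq D n ?m ?ops)"
  proof -
    have "cost (seq_prog D n ops) ?m \<le> snd (run_seq D n ?m ?ops)"
      unfolding run_seq_eq by simp
    then show ?thesis using ops(3) by (meson le_trans mult_le_mono2)
  qed
  ultimately show ?thesis using rooted_forest_parent wt by blast
qed

text \<open>With \<open>N\<close> the binary logarithm of \<open>n\<close> rounded down,
  \<open>b\<close> is a fixed fraction of \<open>N\<close>: small enough for weights to fit into a
  word, large enough for a constant \<open>e\<close>. The exponent \<open>p\<close> takes the rest,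
  so \<open>2 ^ (b + p)\<close> has order \<open>n\<close> and \<open>p - e\<close> has order
  \<open>N\<close>.\<close>

lemma ex_parameters:
  fixes w :: "nat \<Rightarrow> nat"
  assumes "(\<lambda>n. real (w n)) \<in> \<Theta>(\<lambda>n. ln (real n))"
  shows "\<exists>e n0. \<forall>n\<ge>n0. \<exists>b p. b + 1 \<le> w n \<and> 2 * (4 ^ w n + 1) \<le> ((2 :: nat) ^ b) ^ (2 ^ e) \<and>
    2 ^ p + 2 ^ p * (2 * 2 ^ b) \<le> n \<and>
    real n * ln (real n) \<le> 64 * real (2 ^ b * ((p - e) * 2 ^ p))"
proof -
  obtain c1 c2 where c: "c1 > 0" "c2 > 0"
    "eventually (\<lambda>n. real (w n) \<ge> c1 * \<bar>ln (real n)\<bar>) at_top"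
    "eventually (\<lambda>n. real (w n) \<le> c2 * \<bar>ln (real n)\<bar>) at_top"
    using assms unfolding bigtheta_def
    by (auto elim!: landau_o.bigE landau_omega.bigE)
  then have "eventually (\<lambda>n. real (w n) \<ge> c1 * \<bar>ln (real n)\<bar> \<and> real (w n) \<le> c2 * \<bar>ln (real n)\<bar>) at_top"
    by (intro eventually_conj)
  then obtain n1 where n1: "\<And>n. n \<ge> n1 \<Longrightarrow>
      real (w n) \<ge> c1 * \<bar>ln (real n)\<bar> \<and> real (w n) \<le> c2 * \<bar>ln (real n)\<bar>"
    unfolding eventually_at_top_linorder by blast
  \<comment> \<open>These give \<open>a * N \<le> w n \<le> u * N\<close>; the 2 in \<open>u\<close>
    absorbs \<open>N + 1 \<le> 2 * N\<close>.\<close>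
  define a u where "a = c1 * ln 2" and "u = 2 * c2 * ln 2"
  have a: "a > 0" and u: "u > 0" using c by (simp_all add: a_def u_def)
  \<comment> \<open>The bound \<open>K \<ge> 2 / a\<close> yields \<open>2 * b \<le> w n\<close>,
    and \<open>K \<ge> 2\<close> leaves at least half of \<open>N\<close> outside
    \<open>b\<close>.\<close>
  define K where "K = nat \<lceil>2 / a\<rceil> + 2"
  have K: "real K \<ge> 2 / a" "K \<ge> 2" by (simp_all add: K_def) linarith
  obtain e where e: "real (2 ^ e) \<ge> 2 * real K * (2 * u + 2)"
    using real_arch_pow[of 2 "2 * real K * (2 * u + 2)"] by (auto intro: less_imp_le)
  \<comment> \<open>Large enough for \<open>b \<ge> 1\<close>, \<open>N \<le> 2 * K * b\<close> and
    \<open>N \<le> 4 * (p - e)\<close>.\<close>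
  define N1 where "N1 = K + 2 * K + 4 * (e + 2)"
  show ?thesis
  proof (rule exI[of _ e], rule exI[of _ "max n1 (2 ^ N1)"], intro allI impI)
    fix n assume n: "max n1 (2 ^ N1) \<le> n"
    have "n \<ge> 2 ^ N1" using n by simp
    moreover have "(2 :: nat) ^ N1 \<ge> 1" by simp
    ultimately have n_ge1: "n \<ge> 1" by linarith
    obtain N where N: "2 ^ N \<le> n" "n < 2 ^ (N + 1)"
      using ex_power_ivl1[of 2 n] n_ge1 by auto
    have "(2 :: nat) ^ N1 < 2 ^ (N + 1)" using N(2) \<open>n \<ge> 2 ^ N1\<close> by linarith
    then have "N1 < N + 1" by (rule power_less_imp_less_exp[rotated]) simp
    then have NN: "N \<ge> K + 2 * K + 4 * (e + 2)" by (simp add: N1_def)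
    have "real (2 ^ N) \<le> real n" "real n \<le> real (2 ^ (N + 1))"
      using N by (simp_all only: of_nat_le_iff less_imp_le)
    then have rN: "2 ^ N \<le> real n" "real n \<le> 2 ^ (N + 1)" by simp_all
    have "real N * ln 2 = ln (2 ^ N)" by (simp add: ln_realpow)
    also have "\<dots> \<le> ln (real n)"
      using rN n_ge1 by (subst ln_le_cancel_iff) auto
    finally have ln_ge: "real N * ln 2 \<le> ln (real n)" .
    have "ln (real n) \<le> ln (2 ^ (N + 1))"
      using rN n_ge1 by (subst ln_le_cancel_iff) auto
    also have "\<dots> = real (N + 1) * ln 2" by (simp add: ln_realpow del: power_Suc)
    also have "\<dots> \<le> (2 * real N) * ln 2" using NN by (intro mult_right_mono) auto
    finally have ln_le: "ln (real n) \<le> 2 * real N * ln 2" .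
    have ln_nonneg: "ln (real n) \<ge> 0" using n_ge1 by simp
    have w_ge: "a * real N \<le> real (w n)"
    proof -
      have "a * real N = c1 * (real N * ln 2)" by (simp add: a_def)
      also have "\<dots> \<le> c1 * ln (real n)" using ln_ge c by (intro mult_left_mono) auto
      also have "\<dots> \<le> real (w n)" using n1[of n] n ln_nonneg by simp
      finally show ?thesis .
    qed
    have w_le: "real (w n) \<le> u * real N"
    proof -
      have "real (w n) \<le> c2 * ln (real n)" using n1[of n] n ln_nonneg by simp
      also have "\<dots> \<le> c2 * (2 * real N * ln 2)" using ln_le c by (intro mult_left_mono) auto
      finally show ?thesis by (simp add: u_def mult_ac)
    qed
    define b where "b = N div K"
    have Kb_le: "K * b \<le> N" by (simp add: b_def)
    have "N < K * (b + 1)" using K(2) dividend_less_times_div[of K N] by (simp add: b_def algebra_simps)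
    moreover have "2 * K \<le> N" using NN by simp
    ultimately have N_le: "N \<le> 2 * K * b" by simp
    have aK: "a * real K \<ge> 2" using K(1) a by (simp add: field_simps)
    have "b \<ge> 1" using K(2) NN by (simp add: b_def div_greater_zero_iff Suc_le_eq)
    have b_w: "b + 1 \<le> w n"
    proof -
      have "2 * real b \<le> (a * real K) * real b" using aK by (intro mult_right_mono) auto
      also have "\<dots> = a * real (K * b)" by simp
      also have "\<dots> \<le> a * real N" using Kb_le a by (intro mult_left_mono) (auto simp del: of_nat_mult)
      finally have "2 * real b \<le> real (w n)" using w_ge by linarith
      then show ?thesis using \<open>b \<ge> 1\<close> by linarith
    qed
    have b_e: "2 * w n + 2 \<le> b * 2 ^ e"
    proof -
      have "1 \<le> real N" using NN by simp
      then have "real (2 * w n + 2) \<le> (2 * u + 2) * real N" using w_le by (simp add: algebra_simps)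
      also have "\<dots> \<le> (2 * u + 2) * real (2 * K * b)"
        using N_le u by (intro mult_left_mono) (auto simp del: of_nat_mult)
      also have "\<dots> = real b * (2 * real K * (2 * u + 2))" by simp
      also have "\<dots> \<le> real b * real (2 ^ e)" using e by (intro mult_left_mono) auto
      finally show ?thesis by (metis of_nat_le_iff of_nat_mult)
    qed
    \<comment> \<open>The 2 leaves room for a forest of at most \<open>2 ^ p * (4 * 2 ^ b)\<close>
      vertices, which is \<open>2 ^ N\<close>.\<close>
    define p where "p = N - b - 2"
    have "2 * b \<le> K * b" using K(2) by simp
    then have b_le: "2 * b \<le> N" using Kb_le by linarith
    have pN: "b + p + 2 = N" and p_e: "N \<le> 4 * (p - e)" using b_le NN by (auto simp: p_def)
    have "2 * (4 ^ w n + 1) \<le> (4 :: nat) * 4 ^ w n" by simp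
    also have "\<dots> = 2 ^ (2 * w n + 2)" by (simp add: power_mult power_add)
    also have "\<dots> \<le> 2 ^ (b * 2 ^ e)" using b_e by (rule power_increasing) simp
    finally have q: "2 * (4 ^ w n + 1) \<le> ((2 :: nat) ^ b) ^ (2 ^ e)" by (simp add: power_mult)
    have "(2 :: nat) ^ p + 2 ^ p * (2 * 2 ^ b) \<le> 2 ^ p * (4 * 2 ^ b)" by simp
    also have "\<dots> = 2 ^ (b + p + 2)" by (simp add: power_add)
    finally have size: "2 ^ p + 2 ^ p * (2 * 2 ^ b) \<le> n" using N(1) unfolding pN by linarith
    \<comment> \<open>One factor 8 comes from \<open>n < 2 ^ (N + 1)\<close>, the other from
      \<open>ln n \<le> 2 * N \<le> 8 * (p - e)\<close>; together they give 64.\<close>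
    have "n \<le> 8 * 2 ^ (b + p)" using N(2) unfolding pN[symmetric] by simp
    then have "real n \<le> 8 * real (2 ^ (b + p))"
      by (metis of_nat_le_iff of_nat_mult of_nat_numeral)
    moreover have "ln (real n) \<le> 8 * real (p - e)"
    proof -
      have "2 * real N * ln 2 \<le> 2 * real N * 1"
        using ln_2_less_1 by (intro mult_left_mono) auto
      then show ?thesis using ln_le p_e by linarith
    qed
    ultimately have "real n * ln (real n) \<le> (8 * real (2 ^ (b + p))) * (8 * real (p - e))"
      using ln_nonneg by (intro mult_mono) auto
    also have "\<dots> = 64 * real (2 ^ b * ((p - e) * 2 ^ p))" by (simp add: power_add)
    finally show "\<exists>b p. b + 1 \<le> w n \<and> 2 * (4 ^ w n + 1) \<le> ((2 :: nat) ^ b) ^ (2 ^ e) \<and>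
        2 ^ p + 2 ^ p * (2 * 2 ^ b) \<le> n \<and>
        real n * ln (real n) \<le> 64 * real (2 ^ b * ((p - e) * 2 ^ p))"
      using b_w q size by blast
  qed
qed

theorem theorem5:
  fixes w :: "nat \<Rightarrow> nat" and D :: ds
  assumes "(\<lambda>n. real (w n)) \<in> \<Theta>(\<lambda>n. ln (real n))"
    and "ds_correct w D"
  shows "\<exists>c>0. \<exists>n0. \<forall>n\<ge>n0. \<exists>par wt ops.
           rooted_forest n par \<and> (\<forall>x<n. \<bar>wt x\<bar> < 2 ^ w n) \<and>
           length ops = n \<and> legal_ops n par ops \<and>
           real (snd (run_seq D n (ds_init D n par wt) ops)) \<ge> c * real n * ln (real n)"
proof -
  obtain e n0 where params: "\<And>n. n \<ge> n0 \<Longrightarrow> \<exists>b p. b + 1 \<le> w n \<and>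
      2 * (4 ^ w n + 1) \<le> ((2 :: nat) ^ b) ^ (2 ^ e) \<and> 2 ^ p + 2 ^ p * (2 * 2 ^ b) \<le> n \<and>
      real n * ln (real n) \<le> 64 * real (2 ^ b * ((p - e) * 2 ^ p))"
    using ex_parameters[OF assms(1)] by blast
  \<comment> \<open>The 64 is the loss in the choice of parameters, \<open>2 ^ (e + 2)\<close> the
    loss in the transfer bound; \<open>e\<close> is independent of \<open>n\<close>.\<close>
  define c :: real where "c = 1 / (64 * 2 ^ (e + 2))"
  show ?thesis
  proof (intro exI[of _ c] conjI exI[of _ n0] allI impI)
    show "c > 0" by (simp add: c_def)
    fix n assume "n \<ge> n0"
    from params[OF this] obtain b p where bp: "b + 1 \<le> w n"
      "2 * (4 ^ w n + 1) \<le> ((2 :: nat) ^ b) ^ (2 ^ e)" "2 ^ p + 2 ^ p * (2 * 2 ^ b) \<le> n"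
      "real n * ln (real n) \<le> 64 * real (2 ^ b * ((p - e) * 2 ^ p))" by blast
    from ex_expensive_sequence[OF assms(2) bp(1-3)] obtain par wt ops where
      ops: "rooted_forest n par" "\<forall>x<n. \<bar>wt x\<bar> < 2 ^ w n" "length ops = n" "legal_ops n par ops"
      "2 ^ b * ((p - e) * 2 ^ p) \<le> 2 ^ (e + 2) * snd (run_seq D n (ds_init D n par wt) ops)"
      by blast
    let ?t = "snd (run_seq D n (ds_init D n par wt) ops)"
    have "real (2 ^ b * ((p - e) * 2 ^ p)) \<le> real (2 ^ (e + 2) * ?t)"
      using ops(5) by (rule of_nat_mono)
    then have "real n * ln (real n) \<le> 64 * 2 ^ (e + 2) * real ?t"
      using bp(4) by simp
    then have "c * real n * ln (real n) \<le> real ?t"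
      by (simp add: c_def field_simps)
    with ops(1-4) show "\<exists>par wt ops. rooted_forest n par \<and> (\<forall>x<n. \<bar>wt x\<bar> < 2 ^ w n) \<and>
        length ops = n \<and> legal_ops n par ops \<and>
        real (snd (run_seq D n (ds_init D n par wt) ops)) \<ge> c * real n * ln (real n)"
      by blast
  qed
qed

end
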